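(* Let $\Omega\subset\mathbb{X}$ be closed, let $r\in\{1,\ldots,n\}$ be such that $\Gamma_r:=\{X\in\Omega\,|\,\mathrm{rank}(X)\le r\}$ is nonempty, and let $f:\mathbb{X}\to(-\infty,+\infty]$ be bounded from below, coercive on $\Omega$ and locally Lipschitz continuous on $\Omega$. Suppose the mapping $\mathcal{S}_r$ is calm at $0$ for every $X\in\mathcal{S}_r(0)$. Then the problem $$\min_{X\in\Omega}\big\{f(X)\ \ \text{s.t.}\ \ \|X\|_*-\|X\|_{(r)}=0\big\}$$ is partially calm at every local optimal solution $X^*$, i.e., there exist $\varepsilon>0$ and $\overline{\rho}>0$ such that for all $\tau\in\mathbb{R}$ and all $X\in\mathbb{B}(X^*,\varepsilon)\cap\mathcal{S}_r(\tau)$, $$f(X)-f(X^* )+\overline{\rho}\big[\|X\|_*-\|X\|_{(r)}\big]\ge0.$$ Consequently, there exists a threshold $\overline{\rho}>0$ such that for every $\rho\ge\overline{\rho}$ the problem $$\min_{X\in\Omega}\big\{f(X)+\rho\big[\|X\|_*-\|X\|_{(r)}\big]\big\}$$ has the same global optimal solution set as the problem $$\min_{X\in\Omega}\big\{f(X)\ \ \text{s.t.}\ \ \mathrm{rank}(X)\le r\big\}.$$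
   Context: $\mathbb{X}$ denotes either $\mathbb{R}^{n\times m}$ (with $n\le m$) or the space $\mathbb{S}^n$ of $n\times n$ real symmetric matrices, equipped with the trace inner product and the Frobenius norm. $\mathbb{B}(X^*,\varepsilon)$ is the closed ball of radius $\varepsilon$ centered at $X^*$. $\sigma_1(X)\ge\cdots\ge\sigma_n(X)$ are the singular values of $X$; $\|X\|_*=\sum_{i=1}^n\sigma_i(X)$ is the nuclear norm and $\|X\|_{(r)}=\sum_{i=1}^r\sigma_i(X)$ is the Ky-Fan $r$-norm. The multifunction $\mathcal{S}_r:\mathbb{R}\rightrightarrows\mathbb{X}$ is $\mathcal{S}_r(\tau):=\{X\in\Omega\,|\,\|X\|_*-\|X\|_{(r)}=\tau\}$, so $\mathcal{S}_r(0)=\Gamma_r$. $f$ coercive on $\Omega$ means $f(X)\to+\infty$ as $\|X\|_F\to\infty$ with $X\in\Omega$. $f$ locally Lipschitz continuous on $\Omega$ means $f$ is finite on $\Omega$ and each point of $\Omega$ has a neighborhood $N$ such that $f$ is Lipschitz on $N\cap\Omega$. Calmness: a multifunction $\mathcal{M}:\mathbb{Y}\rightrightarrows\mathbb{Z}$ between finite-dimensional Euclidean spaces is calm at $\overline{y}$ for $\overline{z}\in\mathcal{M}(\overline{y})$ if there exist $\gamma\ge0$, $\varepsilon>0$, $\delta>0$ such that for all $y$ with $\|y-\overline{y}\|\le\varepsilon$, $\mathcal{M}(y)\cap\mathbb{B}(\overline{z},\delta)\subseteq\mathcal{M}(\overline{y})+\gamma\|y-\overline{y}\|\mathbb{B}_{\mathbb{Z}}$,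 where $\mathbb{B}_{\mathbb{Z}}$ is the closed unit ball. *)

theory Defs
  imports "HOL-Analysis.Analysis" "HOL-Computational_Algebra.Polynomial"
begin

text \<open>
  A real \<open>n \<times> m\<close> matrix (\<open>n\<close> rows, \<open>m\<close> columns) has type \<open>real^'m^'n\<close>. On this type
  the library inner product and norm are the trace inner product and the Frobenius norm.
\<close>

definition symmetric_matrices :: "(real^'n^'n) set" where
  "symmetric_matrices = {X. transpose X = X}"

definition charpoly :: "real^'n^'n \<Rightarrow> real poly" where
  "charpoly A = det (\<chi> i j. (if i = j then [:0, 1:] else 0) - [:A $ i $ j:])"

text \<open>
  The singular values are the square roots of the eigenvalues of \<open>X X\<^sup>T\<close>, repeated according to
  their multiplicity as roots of the characteristic polynomial and listed in nonincreasing
  order. Since \<open>X X\<^sup>T\<close> is positive semidefinite of size \<open>n\<close>, the list has length \<open>n\<close>.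
\<close>

definition singular_values :: "real^'m^'n \<Rightarrow> real list" where
  "singular_values X =
     rev (sorted_list_of_multiset (image_mset sqrt (proots (charpoly (X ** transpose X)))))"

text \<open>Indices start at 1, so \<open>singular_value X 1\<close> is the largest singular value.\<close>

definition singular_value :: "real^'m^'n \<Rightarrow> nat \<Rightarrow> real" where
  "singular_value X i = singular_values X ! (i - 1)"

definition nuclear_norm :: "real^'m^'n \<Rightarrow> real" where
  "nuclear_norm (X :: real^'m^'n) = (\<Sum>i = 1..CARD('n). singular_value X i)"

definition ky_fan_norm :: "nat \<Rightarrow> real^'m^'n \<Rightarrow> real" where
  "ky_fan_norm r X = (\<Sum>i = 1..r. singular_value X i)"

definition level_map :: "(real^'m^'n) set \<Rightarrow> nat \<Rightarrow> real \<Rightarrow> (real^'m^'n) set" where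
  "level_map \<Omega> r \<tau> = {X \<in> \<Omega>. nuclear_norm X - ky_fan_norm r X = \<tau>}"

definition rank_feasible :: "(real^'m^'n) set \<Rightarrow> nat \<Rightarrow> (real^'m^'n) set" where
  "rank_feasible \<Omega> r = {X \<in> \<Omega>. rank X \<le> r}"

definition calm_at ::
  "('a::euclidean_space \<Rightarrow> 'b::euclidean_space set) \<Rightarrow> 'a \<Rightarrow> 'b \<Rightarrow> bool" where
  "calm_at M y0 z0 \<longleftrightarrow> z0 \<in> M y0 \<and>
     (\<exists>\<gamma>\<ge>0. \<exists>\<epsilon>>0. \<exists>\<delta>>0. \<forall>y. norm (y - y0) \<le> \<epsilon> \<longrightarrow>
        M y \<inter> cball z0 \<delta> \<subseteq> {z + (\<gamma> * norm (y - y0)) *\<^sub>R b | z b. z \<in> M y0 \<and> b \<in> cball 0 1})"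

definition bounded_below_on :: "'a set \<Rightarrow> ('a \<Rightarrow> ereal) \<Rightarrow> bool" where
  "bounded_below_on A f \<longleftrightarrow> (\<exists>c::real. \<forall>x\<in>A. ereal c \<le> f x)"

definition coercive_on :: "'a::real_normed_vector set \<Rightarrow> ('a \<Rightarrow> ereal) \<Rightarrow> bool" where
  "coercive_on A f \<longleftrightarrow> (f \<longlongrightarrow> \<infinity>) (inf at_infinity (principal A))"

definition locally_lipschitz_on :: "'a::metric_space set \<Rightarrow> ('a \<Rightarrow> ereal) \<Rightarrow> bool" where
  "locally_lipschitz_on A f \<longleftrightarrow> (\<forall>x\<in>A. \<bar>f x\<bar> \<noteq> \<infinity>) \<and>
     (\<forall>x\<in>A. \<exists>N L. open N \<and> x \<in> N \<and> L-lipschitz_on (N \<inter> A) (\<lambda>y. real_of_ereal (f y)))"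

definition global_minimizers :: "('a \<Rightarrow> ereal) \<Rightarrow> 'a set \<Rightarrow> 'a set" where
  "global_minimizers f C = {x. is_arg_min f (\<lambda>y. y \<in> C) x}"

definition local_minimizers :: "('a::metric_space \<Rightarrow> ereal) \<Rightarrow> 'a set \<Rightarrow> 'a set" where
  "local_minimizers f C = {x. \<exists>\<delta>>0. is_arg_min f (\<lambda>y. y \<in> C \<inter> cball x \<delta>) x}"

text \<open>Partial calmness at \<open>X0\<close> of minimizing \<open>f\<close> over \<open>level_map \<Omega> r 0\<close>.\<close>

definition partially_calm_at ::
  "(real^'m^'n \<Rightarrow> ereal) \<Rightarrow> (real^'m^'n) set \<Rightarrow> nat \<Rightarrow> real^'m^'n \<Rightarrow> bool" where
  "partially_calm_at f \<Omega> r X0 \<longleftrightarrow>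
     (\<exists>\<epsilon>>0. \<exists>\<rho>>0. \<forall>\<tau>. \<forall>X \<in> cball X0 \<epsilon> \<inter> level_map \<Omega> r \<tau>.
        f X - f X0 + ereal (\<rho> * (nuclear_norm X - ky_fan_norm r X)) \<ge> 0)"

end

theory Submission
  imports Defs
begin

text \<open>
  Write \<open>g X = nuclear_norm X - ky_fan_norm r X\<close>. This is the sum of the \<open>n - r\<close> smallest singular
  values of \<open>X\<close>, so \<open>g \<ge> 0\<close>, and \<open>g X = 0\<close> exactly when \<open>rank X \<le> r\<close>. The theorem is then an exact
  penalty principle for minimizing \<open>f\<close> over the zero set of a nonnegative function \<open>g\<close> on \<open>\<Omega>\<close>.

  Local part (\<open>calm_level_sets_imp_partially_calm\<close>). Let \<open>X\<close> be near a local minimizer \<open>X0\<close>. If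
  \<open>g X\<close> is small, calmness provides a feasible point \<open>Z\<close> at distance at most \<open>\<gamma> * g X\<close>, and the
  Lipschitz bound gives \<open>f X \<ge> f Z - L * \<gamma> * g X \<ge> f X0 - L * \<gamma> * g X\<close>. If \<open>g X\<close> is not small, the
  Lipschitz bound between \<open>X\<close> and \<open>X0\<close> itself loses only a bounded amount, which a large multiple
  of \<open>g X\<close> pays for.

  Global part (\<open>local_penalties_imp_global_penalty\<close>, \<open>exact_penalty\<close>). Let \<open>m\<close> be the minimum of \<open>f\<close>
  over the feasible set. Around every point of the compact set where \<open>f \<le> m\<close>, some multiple \<open>\<rho>\<close>
  makes \<open>f + \<rho> * g \<ge> m\<close>: at feasible points by the local part, at infeasible ones because \<open>g\<close> is
  bounded away from \<open>0\<close> nearby and \<open>f\<close> is bounded below. A finite subcover gives one \<open>\<rho>\<close> for all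
  of \<open>\<Omega>\<close>, and strictly larger multiples admit no infeasible minimizers.

  What remains is linear algebra about \<open>g\<close>. An orthonormal eigenbasis of \<open>X X\<^sup>T\<close> identifies the
  roots of its characteristic polynomial with its eigenvalues, and so provides vectors
  \<open>u 1, \<dots>, u n\<close> whose images under \<open>X\<^sup>T\<close> are orthogonal of lengths
  \<open>singular_value X 1, \<dots>, singular_value X n\<close> (\<open>singular_value_decomposition\<close>). Counting the nonzero
  images gives \<open>g X = 0\<close> for \<open>rank X \<le> r\<close>. Conversely, a subspace of dimension greater than \<open>r\<close>
  on which \<open>X\<^sup>T\<close> stretches by at least \<open>c\<close> forces \<open>g X \<ge> c\<close>
  (\<open>nuclear_minus_ky_fan_lower_bound\<close>). The range of a matrix of rank greater than \<open>r\<close> is such a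
  subspace, also for all matrices close to it, which yields both the other half of the rank
  characterization and the local lower bound on \<open>g\<close> used above.
\<close>

section \<open>Orthonormal eigenbases and the characteristic polynomial\<close>

text \<open>
  A maximizer of the Rayleigh quotient \<open>x \<bullet> f x\<close> on the unit sphere of \<open>S\<close> is an eigenvector.
\<close>

lemma selfadjoint_has_eigenvector:
  fixes f :: "'a::euclidean_space \<Rightarrow> 'a"
  assumes f: "linear f" and sa: "\<And>x y. f x \<bullet> y = x \<bullet> f y"
    and S: "subspace S" "f ` S \<subseteq> S" "S \<noteq> {0}"
  obtains v \<mu> where "v \<in> S" "norm v = 1" "f v = \<mu> *\<^sub>R v"
proof -
  interpret f: linear f by fact
  obtain s where s: "s \<in> S" "s \<noteq> 0"
    using S subspace_0 by blast
  then have "(1 / norm s) *\<^sub>R s \<in> S \<inter> sphere 0 1"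
    using S(1) by (simp add: subspace_scale)
  then have ne: "S \<inter> sphere 0 1 \<noteq> {}" by blast
  have "compact (S \<inter> sphere 0 1)"
    using closed_subspace[OF S(1)] by (metis compact_sphere closed_Int_compact)
  moreover have "continuous_on (S \<inter> sphere 0 1) (\<lambda>x. x \<bullet> f x)"
    by (intro continuous_intros linear_continuous_on) (use f linear_conv_bounded_linear in blast)
  ultimately have "\<exists>v\<in>S \<inter> sphere 0 1. \<forall>x\<in>S \<inter> sphere 0 1. x \<bullet> f x \<le> v \<bullet> f v"
    using ne by (intro continuous_attains_sup)
  then obtain v where v: "v \<in> S" "norm v = 1"
    and max: "\<And>x. x \<in> S \<Longrightarrow> norm x = 1 \<Longrightarrow> x \<bullet> f x \<le> v \<bullet> f v"
    by auto
  define \<mu> where "\<mu> = v \<bullet> f v"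
  \<comment> \<open>By homogeneity \<open>h \<ge> 0\<close> on all of \<open>S\<close>, with equality at the maximizer \<open>v\<close>.\<close>
  define h where "h x = \<mu> * (x \<bullet> x) - x \<bullet> f x" for x
  have h_nonneg: "h x \<ge> 0" if "x \<in> S" for x
  proof (cases "x = 0")
    case False
    have "((1 / norm x) *\<^sub>R x) \<bullet> f ((1 / norm x) *\<^sub>R x) \<le> \<mu>"
      unfolding \<mu>_def using that False S(1) by (intro max) (auto simp: subspace_scale)
    then have "(x \<bullet> f x) / (norm x)\<^sup>2 \<le> \<mu>"
      by (simp add: f.scale power2_eq_square)
    then show ?thesis
      using False by (simp add: h_def field_simps power2_norm_eq_inner)
  qed (simp add: h_def f.zero)
  have v1: "v \<bullet> v = 1"
    using v by (simp add: norm_eq_1)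
  \<comment> \<open>The residual \<open>w\<close> lies in \<open>S\<close>; moving \<open>v\<close> in that direction would push \<open>h\<close> below its
    minimum \<open>0\<close> unless \<open>w = 0\<close>.\<close>
  define w where "w = f v - \<mu> *\<^sub>R v"
  have wS: "w \<in> S"
    unfolding w_def using v S by (intro subspace_diff subspace_scale) auto
  have wv: "w \<bullet> f v - \<mu> * (w \<bullet> v) = w \<bullet> w"
    by (simp add: w_def inner_diff_right inner_diff_left inner_commute algebra_simps)
  have h_along_w: "h (v + t *\<^sub>R w) = t\<^sup>2 * h w - 2 * t * (w \<bullet> w)" for t
  proof -
    have "h (v + t *\<^sub>R w) = \<mu> - v \<bullet> f v + t\<^sup>2 * h w - 2 * t * (w \<bullet> f v - \<mu> * (w \<bullet> v))"
      using v1 sa[of w v] sa[of v w]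
      by (simp add: h_def f.add f.scale inner_add_left inner_add_right inner_commute
          power2_eq_square algebra_simps)
    then show ?thesis by (simp only: wv) (simp add: \<mu>_def)
  qed
  have "w \<bullet> w = 0"
  proof (rule ccontr)
    assume "w \<bullet> w \<noteq> 0"
    then have pos: "w \<bullet> w > 0" by simp
    \<comment> \<open>The linear term of \<open>h_along_w\<close> beats the quadratic one for small \<open>t\<close>; the \<open>+ 1\<close> keeps the
      denominator positive.\<close>
    define t where "t = (w \<bullet> w) / (h w + 1)"
    have hw: "h w \<ge> 0" by (rule h_nonneg[OF wS])
    have t: "t > 0" "t * h w < w \<bullet> w"
      using pos hw by (auto simp: t_def field_simps)
    have "h (v + t *\<^sub>R w) \<ge> 0"
      using v wS S(1) by (intro h_nonneg) (simp add: subspace_add subspace_scale)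
    then have "t * (t * h w - 2 * (w \<bullet> w)) \<ge> 0"
      by (simp add: h_along_w power2_eq_square algebra_simps)
    then have "t * h w \<ge> 2 * (w \<bullet> w)"
      using t(1) by (simp add: zero_le_mult_iff)
    with t pos show False by linarith
  qed
  then show thesis
    using v that[of v \<mu>] by (simp add: w_def)
qed

text \<open>
  Split off one eigenvector \<open>v\<close>: since \<open>f\<close> is self-adjoint, it leaves the orthogonal complement of
  \<open>v\<close> in \<open>S\<close> invariant, and that complement has smaller dimension.
\<close>

lemma selfadjoint_has_orthonormal_eigenbasis:
  fixes f :: "'a::euclidean_space \<Rightarrow> 'a"
  assumes f: "linear f" and sa: "\<And>x y. f x \<bullet> y = x \<bullet> f y"
    and S: "subspace S" "f ` S \<subseteq> S"
  obtains B where "pairwise orthogonal B" "\<And>b. b \<in> B \<Longrightarrow> norm b = 1" "span B = S"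
    "\<And>b. b \<in> B \<Longrightarrow> \<exists>\<mu>. f b = \<mu> *\<^sub>R b"
proof -
  have "\<exists>B. pairwise orthogonal B \<and> (\<forall>b\<in>B. norm b = 1 \<and> (\<exists>\<mu>. f b = \<mu> *\<^sub>R b)) \<and> span B = S"
    using S
  proof (induction "dim S" arbitrary: S rule: less_induct)
    case less
    show ?case
    proof (cases "S = {0}")
      case True
      then show ?thesis by (intro exI[of _ "{}"]) auto
    next
      case False
      obtain v \<mu> where v: "v \<in> S" "norm v = 1" "f v = \<mu> *\<^sub>R v"
        using selfadjoint_has_eigenvector[OF f sa less.prems False] by metis
      have vv: "v \<bullet> v = 1" using v by (simp add: norm_eq_1)
      define T where "T = {x \<in> S. v \<bullet> x = 0}"
      have T: "subspace T"
        unfolding T_def using subspace_inter[OF less.prems(1) subspace_hyperplane[of v]]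
        by (simp add: Int_def)
      have fT: "f ` T \<subseteq> T"
        using less.prems(2) by (auto simp: T_def v simp flip: sa)
      have "v \<notin> T" "T \<subseteq> S"
        using vv by (auto simp: T_def)
      then have "T \<subset> S"
        using v(1) by blast
      then have "dim T < dim S"
        by (metis T dim_psubset less.prems(1) span_eq_iff)
      from less.hyps[OF this T fT] obtain B where
        B: "pairwise orthogonal B" "\<And>b. b \<in> B \<Longrightarrow> norm b = 1 \<and> (\<exists>\<mu>. f b = \<mu> *\<^sub>R b)" "span B = T"
        by blast
      have BT: "B \<subseteq> T" using B(3) span_superset by blast
      have "span (insert v B) = S"
      proof
        show "span (insert v B) \<subseteq> S"
          using BT v(1) \<open>T \<subset> S\<close> less.prems(1) by (intro span_minimal) auto
        show "S \<subseteq> span (insert v B)"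
        proof
          fix x assume "x \<in> S"
          then have "x - (v \<bullet> x) *\<^sub>R v \<in> span B"
            using v(1) vv less.prems(1)
            by (auto simp: B(3) T_def subspace_diff subspace_scale inner_diff_right)
          then show "x \<in> span (insert v B)"
            by (auto simp: span_insert)
        qed
      qed
      moreover have "pairwise orthogonal (insert v B)"
        using B(1) BT by (intro pairwise_orthogonal_insert) (auto simp: T_def orthogonal_def)
      ultimately show ?thesis
        using B(2) v by (intro exI[of _ "insert v B"]) auto
    qed
  qed
  then show thesis using that by blast
qed

lemma symmetric_matrix_orthonormal_eigenvectors:
  fixes A :: "real^'n^'n"
  assumes "transpose A = A"
  obtains e :: "'n \<Rightarrow> real^'n" and d :: "'n \<Rightarrow> real"
  where "\<And>i j. e i \<bullet> e j = (if i = j then 1 else 0)" "\<And>i. A *v e i = d i *\<^sub>R e i"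
proof -
  have "(A *v x) \<bullet> y = x \<bullet> (A *v y)" for x y
    using dot_lmul_matrix[of x A y] by (simp add: assms flip: transpose_matrix_vector)
  then obtain B where B: "pairwise orthogonal B" "\<And>b. b \<in> B \<Longrightarrow> norm b = 1" "span B = UNIV"
    "\<And>b. b \<in> B \<Longrightarrow> \<exists>\<mu>. A *v b = \<mu> *\<^sub>R b"
    using selfadjoint_has_orthonormal_eigenbasis[of "(*v) A" UNIV] by auto
  have ind: "independent B"
    using B(1,2) by (metis norm_zero pairwise_orthogonal_independent zero_neq_one)
  then have "card B = CARD('n)" "finite B"
    using dim_span[of B] by (simp_all add: B(3) ind independent_imp_finite dim_eq_card_independent)
  then obtain e where e: "bij_betw e (UNIV :: 'n set) B"
    using finite_same_card_bij[of "UNIV :: 'n set" B] by auto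
  then have eB: "e i \<in> B" for i
    by (auto simp: bij_betw_def)
  have "e i \<bullet> e j = (if i = j then 1 else 0)" for i j
  proof (cases "i = j")
    case False
    then have "e i \<noteq> e j" using e by (auto simp: bij_betw_def inj_on_def)
    then show ?thesis using B(1) eB False by (auto simp: pairwise_def orthogonal_def)
  qed (use B(2) eB in \<open>simp add: norm_eq_1\<close>)
  moreover have "\<forall>i. \<exists>c. A *v e i = c *\<^sub>R e i"
    using B(4) eB by blast
  then obtain d where "\<And>i. A *v e i = d i *\<^sub>R e i"
    unfolding choice_iff by blast
  ultimately show thesis using that by blast
qed

lemma poly_charpoly: "poly (charpoly A) x = det (mat x - A)"
proof -
  have entry: "poly ((if i = j then [:0, 1:] else 0) - [:A $ i $ j:]) x = (mat x - A) $ i $ j" for i j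
    by (simp add: mat_def)
  show ?thesis
    unfolding charpoly_def det_def poly_sum poly_mult poly_prod vec_lambda_beta entry
    by simp
qed

text \<open>
  With the eigenvectors as the columns of \<open>U\<close>, the matrix \<open>mat x - A\<close> is conjugate to the diagonal
  matrix with entries \<open>x - d i\<close>. The two polynomials therefore agree at every real \<open>x\<close>, which is
  enough over an infinite field.
\<close>

lemma charpoly_orthonormal_eigenvectors:
  fixes A :: "real^'n^'n" and e :: "'n \<Rightarrow> real^'n"
  assumes orth: "\<And>i j. e i \<bullet> e j = (if i = j then 1 else 0)"
    and eig: "\<And>i. A *v e i = d i *\<^sub>R e i"
  shows "charpoly A = (\<Prod>i\<in>UNIV. [:- d i, 1:])"
proof -
  define U :: "real^'n^'n" where "U = (\<chi> i j. e j $ i)"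
  have col: "column j U = e j" for j
    by (simp add: U_def column_def vec_eq_iff)
  have U: "transpose U ** U = mat 1" "U ** transpose U = mat 1"
  proof -
    have "orthogonal_matrix U"
      by (simp add: orthogonal_matrix_orthonormal_columns col orthogonal_def orth norm_eq_1)
    then show "transpose U ** U = mat 1" "U ** transpose U = mat 1"
      by (auto simp: orthogonal_matrix_def)
  qed
  have "poly (charpoly A) x = poly (\<Prod>i\<in>UNIV. [:- d i, 1:]) x" for x
  proof -
    define D :: "real^'n^'n" where "D = (\<chi> i j. if i = j then x - d i else 0)"
    have "(mat x - A) ** U = U ** D"
    proof -
      have "column j ((mat x - A) ** U) = column j (U ** D)" for j
      proof -
        have "column j ((mat x - A) ** U) = (mat x - A) *v e j"
          by (simp add: vec_eq_iff column_def matrix_matrix_mult_def matrix_vector_mult_def U_def)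
        also have "\<dots> = (x - d j) *\<^sub>R e j"
          by (simp add: eig matrix_vector_mult_diff_rdistrib scaleR_left_diff_distrib)
            (simp add: vec_eq_iff matrix_vector_mult_def mat_def if_distrib[of "\<lambda>a. a * _"] cong: if_cong)
        also have "\<dots> = column j (U ** D)"
          by (simp add: vec_eq_iff column_def matrix_matrix_mult_def D_def U_def
              if_distrib[of "\<lambda>a. _ * a"] cong: if_cong)
        finally show ?thesis .
      qed
      then show ?thesis by (simp add: vec_eq_iff column_def)
    qed
    then have "det (mat x - A) * det U = det U * det D"
      by (simp only: flip: det_mul)
    moreover have "det U \<noteq> 0"
      using det_mul[of "transpose U" U] by (auto simp: U(1))
    moreover have "det D = (\<Prod>i\<in>UNIV. x - d i)"
      by (subst det_diagonal) (auto simp: D_def)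
    ultimately show ?thesis
      by (simp add: poly_charpoly poly_prod)
  qed
  then show ?thesis by (rule poly_ext)
qed

section \<open>Singular values\<close>

text \<open>
  The \<open>u i\<close> are orthonormal eigenvectors of \<open>X X\<^sup>T\<close> in the order of the singular values. The vector
  \<open>u i v* X\<close> is \<open>X\<^sup>T (u i)\<close>. The indices start at 1 to match \<open>singular_value\<close>; other values of \<open>u\<close>
  are arbitrary.
\<close>

definition left_singular_basis :: "real^'m^'n \<Rightarrow> (nat \<Rightarrow> real^'n) \<Rightarrow> bool" where
  "left_singular_basis X u \<longleftrightarrow>
     (\<forall>i\<in>{1..CARD('n)}. \<forall>j\<in>{1..CARD('n)}.
        u i \<bullet> u j = (if i = j then 1 else 0) \<and>
        (u i v* X) \<bullet> (u j v* X) = (if i = j then (singular_value X i)\<^sup>2 else 0))"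

text \<open>
  The eigenvalues of \<open>X X\<^sup>T\<close> are the squared lengths of the vectors \<open>X\<^sup>T (e i)\<close>, hence nonnegative,
  and by \<open>charpoly_orthonormal_eigenvectors\<close> they are the roots of its characteristic polynomial with
  multiplicity. So the list of singular values has full length \<open>n\<close>, and sorting the eigenvectors
  along with the values keeps them matched.
\<close>

lemma singular_value_decomposition:
  fixes X :: "real^'m^'n"
  shows left_singular_basis_exists: "\<exists>u. left_singular_basis X u"
    and singular_value_nonneg: "i \<in> {1..CARD('n)} \<Longrightarrow> 0 \<le> singular_value X i"
    and singular_value_antimono: "i \<in> {1..CARD('n)} \<Longrightarrow> j \<in> {1..CARD('n)} \<Longrightarrow> i \<le> j \<Longrightarrow>
       singular_value X j \<le> singular_value X i"
proof -
  have "transpose (X ** transpose X) = X ** transpose X"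
    by (simp add: matrix_transpose_mul)
  then obtain e :: "'n \<Rightarrow> real^'n" and d where
    e: "\<And>i j. e i \<bullet> e j = (if i = j then 1 else 0)"
    and d: "\<And>i. (X ** transpose X) *v e i = d i *\<^sub>R e i"
    using symmetric_matrix_orthonormal_eigenvectors by blast
  have gram: "(e i v* X) \<bullet> (e j v* X) = (if i = j then d i else 0)" for i j
  proof -
    have "(e i v* X) \<bullet> (e j v* X) = e i \<bullet> ((X ** transpose X) *v e j)"
      by (simp add: dot_lmul_matrix flip: matrix_vector_mul_assoc)
    then show ?thesis by (simp add: d e)
  qed
  have d_nonneg: "d i \<ge> 0" for i
    using gram[of i i] inner_ge_zero[of "e i v* X"] by simp
  define h where "h = sqrt \<circ> d"
  have h2: "(h i)\<^sup>2 = d i" "h i \<ge> 0" for i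
    using d_nonneg by (auto simp: h_def)
  obtain xs :: "'n list" where xs: "set xs = UNIV" "distinct xs"
    using finite_distinct_list[of "UNIV :: 'n set"] by auto
  define L where "L = rev (sort_key h xs)"
  have L: "distinct L" "length L = CARD('n)" "sorted (rev (map h L))"
    using xs distinct_card[of xs] by (auto simp: L_def rev_map)
  have "charpoly (X ** transpose X) = (\<Prod>i\<in>UNIV. [:- d i, 1:])"
    by (rule charpoly_orthonormal_eigenvectors[OF e d])
  then have "proots (charpoly (X ** transpose X)) = image_mset d (mset xs)"
    using mset_set_set[OF xs(2)]
    by (simp add: proots_prod xs(1) sum_unfold_sum_mset flip: image_mset_def)
  then have "image_mset sqrt (proots (charpoly (X ** transpose X))) = mset (map h xs)"
    by (simp add: multiset.map_comp comp_def h_def)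
  then have "singular_values X = rev (sort (map h xs))"
    by (simp add: singular_values_def sorted_list_of_multiset_mset del: mset_map)
  also have "sort (map h xs) = map h (sort_key h xs)"
    by (intro properties_for_sort) auto
  finally have sv: "singular_values X = map h L"
    by (simp add: L_def rev_map)
  define u where "u i = e (L ! (i - 1))" for i
  have \<sigma>: "singular_value X i = h (L ! (i - 1))" if "i \<in> {1..CARD('n)}" for i
    using that L(2) by (auto simp: singular_value_def sv)
  have L_eq: "L ! (i - 1) = L ! (j - 1) \<longleftrightarrow> i = j"
    if "i \<in> {1..CARD('n)}" "j \<in> {1..CARD('n)}" for i j
    using that L(1,2) by (subst nth_eq_iff_index_eq) auto
  have u: "left_singular_basis X u"
    unfolding left_singular_basis_def u_def
    by (simp only: e gram L_eq \<sigma> h2 cong: ball_cong) simp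
  show "\<exists>u. left_singular_basis X u"
    by (rule exI[of _ u]) (rule u)
  show "0 \<le> singular_value X i" if "i \<in> {1..CARD('n)}"
    by (simp only: that \<sigma> h2)
  show "singular_value X j \<le> singular_value X i"
    if "i \<in> {1..CARD('n)}" "j \<in> {1..CARD('n)}" "i \<le> j"
    using L(2,3) that by (auto simp: \<sigma> sorted_rev_iff_nth_mono)
qed

text \<open>
  The product \<open>w v* X\<close> combines the rows of \<open>X\<close> with the entries of \<open>w\<close> as coefficients, and the
  Frobenius norm is the Euclidean norm of the vector of row norms; so this is the Cauchy-Schwarz
  inequality.
\<close>

lemma norm_vector_matrix_mult_le:
  fixes X :: "real^'m^'n"
  shows "norm (w v* X) \<le> norm w * norm X"
proof -
  have "w v* X = (\<Sum>i\<in>UNIV. w $ i *\<^sub>R X $ i)"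
    by (simp add: vec_eq_iff vector_matrix_mult_def)
  then have "norm (w v* X) \<le> (\<Sum>i\<in>UNIV. \<bar>w $ i\<bar> * \<bar>norm (X $ i)\<bar>)"
    by (simp add: sum_norm_le)
  also have "\<dots> \<le> norm w * norm X"
    using L2_set_mult_ineq[of "\<lambda>i. norm (w $ i)" "\<lambda>i. norm (X $ i)" UNIV]
    by (simp add: norm_vec_def)
  finally show ?thesis .
qed

section \<open>The gap between nuclear norm and Ky-Fan norm\<close>

lemma nuclear_minus_ky_fan:
  fixes X :: "real^'m^'n"
  assumes "r \<le> CARD('n)"
  shows "nuclear_norm X - ky_fan_norm r X = (\<Sum>i = r + 1..CARD('n). singular_value X i)"
  using assms sum.ub_add_nat[of 1 r "singular_value X" "CARD('n) - r"]
  by (simp add: nuclear_norm_def ky_fan_norm_def)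

lemma nuclear_minus_ky_fan_nonneg:
  fixes X :: "real^'m^'n"
  assumes "r \<le> CARD('n)"
  shows "nuclear_norm X - ky_fan_norm r X \<ge> 0"
  unfolding nuclear_minus_ky_fan[OF assms] by (intro sum_nonneg singular_value_nonneg) auto

text \<open>
  If \<open>singular_value X i\<close> were nonzero for some \<open>i > r\<close>, then \<open>u 1, \<dots>, u i\<close> would have nonzero,
  mutually orthogonal images under \<open>X\<^sup>T\<close>, so that \<open>rank X \<ge> i > r\<close>.
\<close>

lemma nuclear_minus_ky_fan_eq_0_if_rank_le:
  fixes X :: "real^'m^'n"
  assumes r: "r \<le> CARD('n)" and rank: "rank X \<le> r"
  shows "nuclear_norm X - ky_fan_norm r X = 0"
proof -
  obtain u where u: "left_singular_basis X u"
    using left_singular_basis_exists by blast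
  have "singular_value X i = 0" if i: "i \<in> {r + 1..CARD('n)}" for i
  proof (rule ccontr)
    assume "singular_value X i \<noteq> 0"
    then have pos: "singular_value X k > 0" if "k \<in> {1..i}" for k
      using singular_value_antimono[of k i X] singular_value_nonneg[of i X] i that by fastforce
    let ?B = "(\<lambda>k. u k v* X) ` {1..i}"
    have inn: "(u k v* X) \<bullet> (u l v* X) = (if k = l then (singular_value X k)\<^sup>2 else 0)"
      if "k \<in> {1..i}" "l \<in> {1..i}" for k l
      using u i that by (auto simp: left_singular_basis_def)
    have inj: "inj_on (\<lambda>k. u k v* X) {1..i}"
    proof (rule inj_onI)
      fix k l assume kl: "k \<in> {1..i}" "l \<in> {1..i}" "u k v* X = u l v* X"
      then show "k = l"
        using inn[of k l] inn[of k k] pos[of k] by (auto split: if_splits)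
    qed
    have "independent ?B"
    proof (rule pairwise_orthogonal_independent)
      show "pairwise orthogonal ?B"
        using inn by (auto simp: pairwise_def orthogonal_def)
      show "0 \<notin> ?B"
        using inn pos by force
    qed
    moreover have "?B \<subseteq> range ((*v) (transpose X))"
      by auto
    ultimately have "card ?B \<le> dim (range ((*v) (transpose X)))"
      by (intro independent_card_le_dim) auto
    then have "i \<le> rank X"
      unfolding card_image[OF inj] rank_dim_range[symmetric] rank_transpose by simp
    then show False using rank i by simp
  qed
  then show ?thesis
    by (simp add: nuclear_minus_ky_fan[OF r])
qed

text \<open>
  One half of the Courant-Fischer principle. For dimension reasons \<open>W\<close> contains a nonzero
  combination \<open>w\<close> of \<open>u (r + 1), \<dots>, u n\<close>. On such combinations \<open>X\<^sup>T\<close> stretches by at most the largest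
  of the last \<open>n - r\<close> singular values, which is at most their sum.
\<close>

lemma nuclear_minus_ky_fan_lower_bound:
  fixes X :: "real^'m^'n"
  assumes r: "r \<le> CARD('n)" and W: "subspace W" "r < dim W"
    and c: "\<And>w. w \<in> W \<Longrightarrow> c * norm w \<le> norm (w v* X)"
  shows "c \<le> nuclear_norm X - ky_fan_norm r X"
proof -
  let ?I = "{r + 1..CARD('n)}"
  obtain u where u: "left_singular_basis X u"
    using left_singular_basis_exists by blast
  have orthI: "u i \<bullet> u j = (if i = j then 1 else 0)" if "i \<in> ?I" "j \<in> ?I" for i j
    using u that by (auto simp: left_singular_basis_def)
  have gramI: "(u i v* X) \<bullet> (u j v* X) = (if i = j then (singular_value X i)\<^sup>2 else 0)"
    if "i \<in> ?I" "j \<in> ?I" for i j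
    using u that by (auto simp: left_singular_basis_def)
  have inj: "inj_on u ?I"
  proof (rule inj_onI)
    fix i j assume "i \<in> ?I" "j \<in> ?I" "u i = u j"
    then show "i = j"
      using orthI[of i j] orthI[of i i] by (auto split: if_splits)
  qed
  have "independent (u ` ?I)"
  proof (rule pairwise_orthogonal_independent)
    show "pairwise orthogonal (u ` ?I)"
      using orthI by (auto simp: pairwise_def orthogonal_def)
    show "0 \<notin> u ` ?I"
      using orthI by force
  qed
  then have "dim (span (u ` ?I)) = CARD('n) - r"
    using card_image[OF inj] by (simp add: dim_eq_card_independent)
  moreover have "dim {x + y |x y. x \<in> W \<and> y \<in> span (u ` ?I)} \<le> CARD('n)"
    by (rule order_trans[OF dim_subset_UNIV]) simp
  ultimately have "dim (W \<inter> span (u ` ?I)) > 0"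
    using dim_sums_Int[OF W(1) subspace_span[of "u ` ?I"]] W(2) r by linarith
  then obtain w where w: "w \<in> W" "w \<in> span (u ` ?I)" "w \<noteq> 0"
    by (metis Int_iff dim_eq_0 gr_implies_not0 insertCI subsetI)
  obtain a where "w = (\<Sum>v\<in>u ` ?I. a v *\<^sub>R v)"
    using w(2) by (auto simp: span_finite)
  then have wa: "w = (\<Sum>i\<in>?I. a (u i) *\<^sub>R u i)"
    using sum.reindex[OF inj, of "\<lambda>v. a v *\<^sub>R v"] by simp
  have "(norm w)\<^sup>2 = (\<Sum>i\<in>?I. (norm (a (u i) *\<^sub>R u i))\<^sup>2)"
    unfolding wa
    by (rule norm_sum_Pythagorean) (auto simp: pairwise_def orthogonal_def orthI)
  also have "\<dots> = (\<Sum>i\<in>?I. (a (u i))\<^sup>2)"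
    by (intro sum.cong refl) (simp only: power2_norm_eq_inner inner_scaleR_left inner_scaleR_right orthI,
        simp add: power2_eq_square)
  finally have norm_w: "(norm w)\<^sup>2 = (\<Sum>i\<in>?I. (a (u i))\<^sup>2)" .
  have "w v* X = transpose X *v (\<Sum>i\<in>?I. a (u i) *\<^sub>R u i)"
    by (simp only: wa transpose_matrix_vector)
  also have "\<dots> = (\<Sum>i\<in>?I. a (u i) *\<^sub>R (u i v* X))"
    by (simp only: linear_sum[OF matrix_vector_mul_linear] matrix_vector_mult_scaleR transpose_matrix_vector)
  finally have "(norm (w v* X))\<^sup>2 = (norm (\<Sum>i\<in>?I. a (u i) *\<^sub>R (u i v* X)))\<^sup>2"
    by simp
  also have "\<dots> = (\<Sum>i\<in>?I. (norm (a (u i) *\<^sub>R (u i v* X)))\<^sup>2)"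
    by (rule norm_sum_Pythagorean) (auto simp: pairwise_def orthogonal_def gramI)
  also have "\<dots> = (\<Sum>i\<in>?I. (a (u i))\<^sup>2 * (singular_value X i)\<^sup>2)"
    by (intro sum.cong refl) (simp only: power2_norm_eq_inner inner_scaleR_left inner_scaleR_right gramI,
        simp add: power2_eq_square)
  finally have norm_wX: "(norm (w v* X))\<^sup>2 = (\<Sum>i\<in>?I. (a (u i))\<^sup>2 * (singular_value X i)\<^sup>2)" .
  define G where "G = nuclear_norm X - ky_fan_norm r X"
  have G: "0 \<le> G"
    unfolding G_def by (rule nuclear_minus_ky_fan_nonneg[OF r])
  have "singular_value X i \<le> G" if "i \<in> ?I" for i
    unfolding G_def nuclear_minus_ky_fan[OF r]
    using that by (intro member_le_sum singular_value_nonneg) auto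
  then have "(\<Sum>i\<in>?I. (a (u i))\<^sup>2 * (singular_value X i)\<^sup>2) \<le> (\<Sum>i\<in>?I. (a (u i))\<^sup>2 * G\<^sup>2)"
    by (intro sum_mono mult_left_mono power_mono singular_value_nonneg) auto
  then have "(norm (w v* X))\<^sup>2 \<le> (G * norm w)\<^sup>2"
    by (simp add: norm_w norm_wX power_mult_distrib mult.commute sum_distrib_left)
  then have "norm (w v* X) \<le> G * norm w"
    using G by (simp add: power2_le_iff_abs_le)
  with c[OF w(1)] have "c * norm w \<le> G * norm w"
    by linarith
  then show ?thesis
    using w(3) by (simp add: G_def)
qed

text \<open>
  The kernel of \<open>X\<^sup>T\<close> is orthogonal to the range \<open>W\<close> of \<open>X\<close>, so \<open>X\<^sup>T\<close> is injective on \<open>W\<close> and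
  stretches there by some \<open>c > 0\<close>. The transpose of a matrix at distance less than \<open>c / 2\<close> from \<open>X\<close>
  still stretches \<open>W\<close> by \<open>c / 2\<close>.
\<close>

lemma nuclear_minus_ky_fan_pos_near_rank_gt:
  fixes X :: "real^'m^'n"
  assumes r: "r \<le> CARD('n)" and rank: "r < rank X"
  shows "\<exists>c>0. \<forall>\<^sub>F Y in nhds X. c \<le> nuclear_norm Y - ky_fan_norm r Y"
proof -
  let ?W = "range ((*v) X)"
  have W: "subspace ?W" "r < dim ?W"
    using rank by (auto simp: rank_dim_range intro!: linear_subspace_image)
  have ker: "w = 0" if wW: "w \<in> ?W" and w0: "transpose X *v w = 0" for w
  proof -
    obtain x where "w = X *v x" using wW by blast
    then have "w \<bullet> w = (w v* X) \<bullet> x"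
      by (simp add: dot_lmul_matrix)
    then show ?thesis using w0 by simp
  qed
  obtain c where c: "c > 0" "\<And>w. w \<in> ?W \<Longrightarrow> c * norm w \<le> norm (w v* X)"
    using injective_imp_isometric[OF closed_subspace[OF W(1)] W(1), of "(*v) (transpose X)"]
    using ker by (auto simp: matrix_vector_mul_bounded_linear)
  have "c / 2 \<le> nuclear_norm Y - ky_fan_norm r Y" if Y: "dist Y X < c / 2" for Y
  proof (rule nuclear_minus_ky_fan_lower_bound[OF r W])
    fix w assume "w \<in> ?W"
    have "w v* X = w v* Y - w v* (Y - X)"
      by (simp add: vector_matrix_mult_diff_rdistrib)
    then have "norm (w v* X) \<le> norm (w v* Y) + norm (w v* (Y - X))"
      by (metis norm_triangle_ineq4)
    also have "norm (w v* (Y - X)) \<le> norm w * norm (Y - X)"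
      by (rule norm_vector_matrix_mult_le)
    also have "\<dots> \<le> norm w * (c / 2)"
      using Y by (intro mult_left_mono) (auto simp: dist_norm)
    finally show "c / 2 * norm w \<le> norm (w v* Y)"
      using c(2)[OF \<open>w \<in> ?W\<close>] by (simp add: algebra_simps)
  qed
  then show ?thesis
    using c(1) unfolding eventually_nhds_metric by (intro exI[of _ "c / 2"] conjI) auto
qed

lemma nuclear_minus_ky_fan_eq_0_iff:
  fixes X :: "real^'m^'n"
  assumes "r \<le> CARD('n)"
  shows "nuclear_norm X - ky_fan_norm r X = 0 \<longleftrightarrow> rank X \<le> r"
proof
  assume *: "nuclear_norm X - ky_fan_norm r X = 0"
  show "rank X \<le> r"
  proof (rule ccontr)
    assume "\<not> rank X \<le> r"
    then obtain c where "c > 0" "\<forall>\<^sub>F Y in nhds X. c \<le> nuclear_norm Y - ky_fan_norm r Y"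
      using nuclear_minus_ky_fan_pos_near_rank_gt[OF assms, of X] by (meson not_le)
    then show False using * eventually_nhds_x_imp_x by fastforce
  qed
qed (rule nuclear_minus_ky_fan_eq_0_if_rank_le[OF assms])

lemma level_map_0_eq_rank_feasible:
  fixes \<Omega> :: "(real^'m^'n) set"
  assumes "r \<le> CARD('n)"
  shows "level_map \<Omega> r 0 = rank_feasible \<Omega> r"
  by (simp only: level_map_def rank_feasible_def nuclear_minus_ky_fan_eq_0_iff[OF assms])

section \<open>Exact penalization under calmness\<close>

text \<open>
  A point \<open>x\<close> with small \<open>g x\<close> is compared with the nearby zero \<open>z\<close> of \<open>g\<close> that calmness provides, a
  point with large \<open>g x\<close> directly with \<open>x0\<close>.
\<close>

lemma calm_level_sets_imp_partially_calm:
  fixes \<phi> g :: "'a::euclidean_space \<Rightarrow> real"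
  assumes g: "\<And>x. x \<in> \<Omega> \<Longrightarrow> g x \<ge> 0"
    and calm: "calm_at (\<lambda>t. {x \<in> \<Omega>. g x = t}) (0::real) x0"
    and N: "open N" "x0 \<in> N" and lip: "L-lipschitz_on (N \<inter> \<Omega>) \<phi>"
    and d: "d > 0" and locmin: "\<And>x. x \<in> \<Omega> \<Longrightarrow> g x = 0 \<Longrightarrow> dist x0 x \<le> d \<Longrightarrow> \<phi> x0 \<le> \<phi> x"
  shows "\<exists>\<epsilon>>0. \<exists>\<rho>>0. \<forall>x \<in> \<Omega> \<inter> cball x0 \<epsilon>. \<phi> x0 \<le> \<phi> x + \<rho> * g x"
proof -
  obtain \<gamma> \<epsilon>1 \<delta> where calm': "\<gamma> \<ge> 0" "\<epsilon>1 > 0" "\<delta> > 0"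
    and sub: "\<And>t::real. norm (t - 0) \<le> \<epsilon>1 \<Longrightarrow> {x \<in> \<Omega>. g x = t} \<inter> cball x0 \<delta> \<subseteq>
       {z + (\<gamma> * norm (t - 0)) *\<^sub>R b | z b. z \<in> {x \<in> \<Omega>. g x = 0} \<and> b \<in> cball 0 1}"
    and x0: "x0 \<in> \<Omega>" "g x0 = 0"
    using calm unfolding calm_at_def by blast
  obtain \<eta>0 where \<eta>0: "\<eta>0 > 0" "cball x0 \<eta>0 \<subseteq> N"
    using N open_contains_cball by blast
  define \<eta> where "\<eta> = min d \<eta>0"
  have \<eta>: "\<eta> > 0" "\<eta> \<le> d" "cball x0 \<eta> \<subseteq> N"
    using \<eta>0 d by (auto simp: \<eta>_def)
  have L: "L \<ge> 0" using lip by (rule lipschitz_on_nonneg)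
  have lip': "\<phi> y - L * dist x y \<le> \<phi> x"
    if "x \<in> \<Omega>" "y \<in> \<Omega>" "x \<in> cball x0 \<eta>" "y \<in> cball x0 \<eta>" for x y
  proof -
    have "x \<in> N \<inter> \<Omega>" "y \<in> N \<inter> \<Omega>"
      using that \<eta>(3) by blast+
    from lipschitz_onD[OF lip this] show ?thesis
      by (simp add: dist_real_def)
  qed
  \<comment> \<open>Up to \<open>t0\<close> calmness applies and its \<open>z\<close> stays within \<open>\<eta>\<close> of \<open>x0\<close>: half of \<open>\<eta>\<close> is spent on
    \<open>x\<close>, the other half on \<open>\<gamma> * t0\<close>. The \<open>+ 1\<close> covers \<open>\<gamma> = 0\<close>.\<close>
  define t0 where "t0 = min \<epsilon>1 (\<eta> / (2 * (\<gamma> + 1)))"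
  have t0: "t0 > 0" "t0 \<le> \<epsilon>1" "\<gamma> * t0 \<le> \<eta> / 2"
  proof -
    show "t0 > 0" "t0 \<le> \<epsilon>1" using calm' \<eta> by (auto simp: t0_def)
    have "\<gamma> * t0 \<le> (\<gamma> + 1) * (\<eta> / (2 * (\<gamma> + 1)))"
      using calm' \<eta> by (intro mult_mono) (auto simp: t0_def)
    also have "\<dots> = \<eta> / 2" using calm' by (simp add: field_simps)
    finally show "\<gamma> * t0 \<le> \<eta> / 2" .
  qed
  \<comment> \<open>The first summand serves \<open>g x \<le> t0\<close>, the second \<open>g x > t0\<close>; the third makes \<open>\<rho>\<close> positive.\<close>
  define \<rho> where "\<rho> = L * \<gamma> + L * \<eta> / t0 + 1"
  have parts: "L * \<gamma> \<ge> 0" "L * \<eta> / t0 \<ge> 0"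
    using L calm' \<eta> t0 by auto
  have \<rho>: "\<rho> > 0" "L * \<gamma> \<le> \<rho>" "L * \<eta> / t0 \<le> \<rho>"
    unfolding \<rho>_def using parts by linarith+
  have "\<phi> x0 \<le> \<phi> x + \<rho> * g x" if x: "x \<in> \<Omega>" "dist x0 x \<le> min \<delta> (\<eta> / 2)" for x
  proof (cases "g x \<le> t0")
    case True
    have "norm (g x - 0) \<le> \<epsilon>1"
      using True t0 g[OF x(1)] by simp
    from sub[OF this] obtain z b where zb: "x = z + (\<gamma> * g x) *\<^sub>R b"
      "z \<in> \<Omega>" "g z = 0" "norm b \<le> 1"
      using x g[OF x(1)] by fastforce
    have "dist x z = \<gamma> * g x * norm b"
      using zb(1) calm'(1) g[OF x(1)] by (metis abs_of_nonneg add_diff_cancel_left' dist_norm mult_nonneg_nonneg norm_scaleR)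
    also have "\<dots> \<le> \<gamma> * g x"
      using zb(4) calm'(1) g[OF x(1)] by (simp add: mult_left_le)
    finally have xz: "dist x z \<le> \<gamma> * g x" .
    also have "\<dots> \<le> \<gamma> * t0"
      using True calm'(1) by (rule mult_left_mono)
    finally have "dist x0 z \<le> \<eta>"
      using dist_triangle[of x0 z x] x(2) t0(3) by simp
    moreover from this have "\<phi> x0 \<le> \<phi> z"
      using \<eta>(2) zb by (intro locmin) auto
    ultimately have "\<phi> x0 - L * dist x z \<le> \<phi> x"
      using lip'[of x z] x \<eta>(1) zb(2) by fastforce
    moreover have "L * dist x z \<le> L * (\<gamma> * g x)"
      using xz L by (rule mult_left_mono)
    moreover have "L * \<gamma> * g x \<le> \<rho> * g x"
      using \<rho>(2) g[OF x(1)] by (rule mult_right_mono)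
    ultimately show ?thesis by (simp add: mult.assoc)
  next
    case False
    have "\<phi> x0 - L * dist x x0 \<le> \<phi> x"
      using lip'[of x x0] x x0 \<eta>(1) by auto
    moreover have "L * dist x x0 \<le> L * \<eta>"
      using x(2) \<eta>(1) L by (intro mult_left_mono) (auto simp: dist_commute)
    moreover have "L * \<eta> = L * \<eta> / t0 * t0"
      using t0 by simp
    moreover have "L * \<eta> / t0 * t0 \<le> \<rho> * g x"
      using \<rho> parts False t0(1) by (intro mult_mono) auto
    ultimately show ?thesis by linarith
  qed
  then show ?thesis
    using calm'(3) \<eta>(1) \<rho>(1) by (intro exI[of _ "min \<delta> (\<eta> / 2)"] conjI exI[of _ \<rho>]) auto
qed

text \<open>
  Compactness turns locally sufficient multiples of \<open>g\<close> into a single one, the largest in a finite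
  subcover. Where \<open>\<phi> > m\<close> any nonnegative multiple will do.
\<close>

lemma local_penalties_imp_global_penalty:
  fixes \<phi> g :: "'a::topological_space \<Rightarrow> real"
  assumes g: "\<And>x. x \<in> \<Omega> \<Longrightarrow> g x \<ge> 0"
    and K: "compact {x \<in> \<Omega>. \<phi> x \<le> m}"
    and loc: "\<And>x. x \<in> \<Omega> \<Longrightarrow> \<phi> x \<le> m \<Longrightarrow> \<exists>\<rho>. \<forall>\<^sub>F y in nhds x. y \<in> \<Omega> \<longrightarrow> m \<le> \<phi> y + \<rho> * g y"
  shows "\<exists>\<rho>>0. \<forall>x\<in>\<Omega>. m \<le> \<phi> x + \<rho> * g x"
proof -
  let ?K = "{x \<in> \<Omega>. \<phi> x \<le> m}"
  have "\<forall>x\<in>?K. \<exists>U \<rho>. open U \<and> x \<in> U \<and> (\<forall>y\<in>U. y \<in> \<Omega> \<longrightarrow> m \<le> \<phi> y + \<rho> * g y)"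
    using loc unfolding eventually_nhds by blast
  then obtain U \<rho> where
    U: "\<forall>x\<in>?K. open (U x) \<and> x \<in> U x \<and> (\<forall>y\<in>U x. y \<in> \<Omega> \<longrightarrow> m \<le> \<phi> y + \<rho> x * g y)"
    unfolding bchoice_iff by blast
  obtain C where C: "C \<subseteq> ?K" "finite C" "?K \<subseteq> (\<Union>x\<in>C. U x)"
    using compactE_image[OF K, of ?K U] U by blast
  define R where "R = Max (insert 1 (\<rho> ` C))"
  have R: "R \<ge> 1" "\<And>x. x \<in> C \<Longrightarrow> \<rho> x \<le> R"
    using C(2) by (auto simp: R_def)
  have "m \<le> \<phi> y + R * g y" if y: "y \<in> \<Omega>" for y
  proof (cases "\<phi> y \<le> m")
    case True
    then obtain x where x: "x \<in> C" "y \<in> U x"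
      using C(3) y by blast
    then have "m \<le> \<phi> y + \<rho> x * g y"
      using U C(1) y by blast
    also have "\<rho> x * g y \<le> R * g y"
      using R(2)[OF x(1)] g[OF y] by (rule mult_right_mono)
    finally show ?thesis by simp
  next
    case False
    moreover have "0 \<le> R * g y" using R(1) g[OF y] by simp
    ultimately show ?thesis by linarith
  qed
  then show ?thesis using R(1) by (intro exI[of _ R]) auto
qed

lemma coercive_on_imp_bounded_sublevel:
  assumes "coercive_on \<Omega> f"
  shows "bounded {x \<in> \<Omega>. f x \<le> ereal c}"
proof -
  have "\<forall>\<^sub>F x in inf at_infinity (principal \<Omega>). ereal c < f x"
    using assms unfolding coercive_on_def by (rule order_tendstoD) simp
  then obtain b where "\<And>x. norm x \<ge> b \<Longrightarrow> x \<in> \<Omega> \<Longrightarrow> ereal c < f x"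
    by (auto simp: eventually_inf_principal eventually_at_infinity)
  then show ?thesis
    by (intro boundedI[of _ b]) (fastforce simp: not_less[symmetric])
qed

text \<open>
  The hypothesis \<open>lower\<close> serves twice. It makes the zero set of \<open>g\<close> closed, so that \<open>f\<close>, being coercive,
  attains its minimum \<open>m\<close> there; and near a point outside that set it lets a large multiple of \<open>g\<close> lift
  the lower bound of \<open>f\<close> to \<open>m\<close>.
\<close>

lemma exact_penalty:
  fixes f :: "'a::euclidean_space \<Rightarrow> ereal" and g :: "'a \<Rightarrow> real"
  assumes \<Omega>: "closed \<Omega>" and f: "bounded_below_on \<Omega> f" "coercive_on \<Omega> f" "locally_lipschitz_on \<Omega> f"
    and g: "\<And>x. x \<in> \<Omega> \<Longrightarrow> g x \<ge> 0"
    and lower: "\<And>x. x \<in> \<Omega> \<Longrightarrow> g x \<noteq> 0 \<Longrightarrow> \<exists>c>0. \<forall>\<^sub>F y in nhds x. c \<le> g y"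
    and ne: "{x \<in> \<Omega>. g x = 0} \<noteq> {}"
    and calm: "\<And>x. x \<in> \<Omega> \<Longrightarrow> g x = 0 \<Longrightarrow> calm_at (\<lambda>t. {x \<in> \<Omega>. g x = t}) (0::real) x"
  shows partially_calm_at_local_minimizer:
      "\<And>x0. x0 \<in> local_minimizers f {x \<in> \<Omega>. g x = 0} \<Longrightarrow>
        \<exists>\<epsilon>>0. \<exists>\<rho>>0. \<forall>x \<in> \<Omega> \<inter> cball x0 \<epsilon>. f x - f x0 + ereal (\<rho> * g x) \<ge> 0"
    and exact_penalty_threshold:
      "\<exists>\<rho>0>0. \<forall>\<rho>\<ge>\<rho>0. global_minimizers (\<lambda>x. f x + ereal (\<rho> * g x)) \<Omega> =
        global_minimizers f {x \<in> \<Omega>. g x = 0}"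
proof -
  let ?\<Gamma> = "{x \<in> \<Omega>. g x = 0}"
  define \<phi> where "\<phi> x = real_of_ereal (f x)" for x
  have f_\<phi>: "f x = ereal (\<phi> x)" if "x \<in> \<Omega>" for x
    using f(3) that by (simp add: locally_lipschitz_on_def \<phi>_def ereal_real)
  have lip: "\<exists>N L. open N \<and> x \<in> N \<and> L-lipschitz_on (N \<inter> \<Omega>) \<phi>" if "x \<in> \<Omega>" for x
    using f(3) that by (simp add: locally_lipschitz_on_def \<phi>_def[abs_def])
  have pc: "\<exists>\<epsilon>>0. \<exists>\<rho>>0. \<forall>x \<in> \<Omega> \<inter> cball x0 \<epsilon>. \<phi> x0 \<le> \<phi> x + \<rho> * g x"
    if x0_min: "x0 \<in> local_minimizers f ?\<Gamma>" for x0
  proof -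
    obtain d where d: "d > 0" "is_arg_min f (\<lambda>y. y \<in> ?\<Gamma> \<inter> cball x0 d) x0"
      using x0_min by (auto simp: local_minimizers_def)
    then have x0: "x0 \<in> \<Omega>" "g x0 = 0"
      by (auto simp: is_arg_min_def)
    have "\<phi> x0 \<le> \<phi> x" if "x \<in> \<Omega>" "g x = 0" "dist x0 x \<le> d" for x
      using d(2) that f_\<phi>[OF x0(1)] f_\<phi>[OF that(1)] by (fastforce simp: is_arg_min_def not_less)
    then show ?thesis
      using calm_level_sets_imp_partially_calm[OF g calm[OF x0] _ _ _ d(1), of _ _ \<phi>] lip[OF x0(1)]
      by blast
  qed
  show "\<exists>\<epsilon>>0. \<exists>\<rho>>0. \<forall>x \<in> \<Omega> \<inter> cball x0 \<epsilon>. f x - f x0 + ereal (\<rho> * g x) \<ge> 0"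
    if x0: "x0 \<in> local_minimizers f ?\<Gamma>" for x0
  proof -
    have "x0 \<in> \<Omega>" using x0 by (auto simp: local_minimizers_def is_arg_min_def)
    obtain \<epsilon> \<rho> where \<epsilon>\<rho>: "\<epsilon> > 0" "\<rho> > 0" "\<forall>x \<in> \<Omega> \<inter> cball x0 \<epsilon>. \<phi> x0 \<le> \<phi> x + \<rho> * g x"
      using pc[OF x0] by blast
    have "f x - f x0 + ereal (\<rho> * g x) \<ge> 0" if "x \<in> \<Omega> \<inter> cball x0 \<epsilon>" for x
      using bspec[OF \<epsilon>\<rho>(3) that] that \<open>x0 \<in> \<Omega>\<close> by (auto simp: f_\<phi>)
    then show ?thesis using \<epsilon>\<rho>(1,2) by blast
  qed
  have cont: "continuous_on \<Omega> \<phi>"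
    unfolding continuous_on_eq_continuous_within
  proof
    fix x assume x: "x \<in> \<Omega>"
    obtain N L where N: "open N" "x \<in> N" "L-lipschitz_on (N \<inter> \<Omega>) \<phi>"
      using lip[OF x] by blast
    have "continuous (at x within N \<inter> \<Omega>) \<phi>"
      using lipschitz_on_continuous_on[OF N(3)] N(2) x by (simp add: continuous_on_eq_continuous_within)
    moreover have "at x within N \<inter> \<Omega> = at x within \<Omega>"
      using N(1,2) by (intro at_within_nhd[of x N]) auto
    ultimately show "continuous (at x within \<Omega>) \<phi>" by simp
  qed
  have compact_sub: "compact {x \<in> \<Omega>. \<phi> x \<le> c}" for c
  proof -
    have "{x \<in> \<Omega>. \<phi> x \<le> c} = {x \<in> \<Omega>. f x \<le> ereal c}"
      by (auto simp: f_\<phi>)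
    then have "bounded {x \<in> \<Omega>. \<phi> x \<le> c}"
      using coercive_on_imp_bounded_sublevel[OF f(2)] by simp
    moreover have "closed {x \<in> \<Omega>. \<phi> x \<le> c}"
      using continuous_closed_preimage[OF cont \<Omega> closed_atMost[of c]]
      by (simp add: vimage_def Int_def)
    ultimately show ?thesis by (simp add: compact_eq_bounded_closed)
  qed
  obtain x1 where x1: "x1 \<in> \<Omega>" "g x1 = 0" "\<And>y. y \<in> \<Omega> \<Longrightarrow> g y = 0 \<Longrightarrow> \<phi> x1 \<le> \<phi> y"
  proof -
    obtain x2 where x2: "x2 \<in> \<Omega>" "g x2 = 0" using ne by blast
    have open_pos: "\<exists>U. open U \<and> x \<in> U \<and> U \<inter> ?\<Gamma> = {}" if "x \<in> \<Omega>" "g x \<noteq> 0" for x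
      using lower[OF that] unfolding eventually_nhds by fastforce
    have "closed ?\<Gamma>"
      unfolding closed_def
    proof (subst open_subopen, intro ballI)
      fix x assume "x \<in> - ?\<Gamma>"
      then consider "x \<in> - \<Omega>" | "x \<in> \<Omega>" "g x \<noteq> 0" by blast
      then show "\<exists>T. open T \<and> x \<in> T \<and> T \<subseteq> - ?\<Gamma>"
      proof cases
        case 1
        then show ?thesis using \<Omega> by (intro exI[of _ "- \<Omega>"]) auto
      next
        case 2
        from open_pos[OF this] obtain U where "open U" "x \<in> U" "U \<inter> ?\<Gamma> = {}"
          by (elim exE conjE)
        then show ?thesis by (intro exI[of _ U] conjI) (assumption | simp only: disjoint_eq_subset_Compl)+
      qed
    qed
    then have "compact ({x \<in> \<Omega>. \<phi> x \<le> \<phi> x2} \<inter> ?\<Gamma>)"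
      using compact_sub by (rule compact_Int_closed[rotated])
    moreover have "x2 \<in> {x \<in> \<Omega>. \<phi> x \<le> \<phi> x2} \<inter> ?\<Gamma>" using x2 by simp
    moreover have "continuous_on ({x \<in> \<Omega>. \<phi> x \<le> \<phi> x2} \<inter> ?\<Gamma>) \<phi>"
      by (rule continuous_on_subset[OF cont]) blast
    ultimately have "\<exists>x1\<in>{x \<in> \<Omega>. \<phi> x \<le> \<phi> x2} \<inter> ?\<Gamma>. \<forall>y\<in>{x \<in> \<Omega>. \<phi> x \<le> \<phi> x2} \<inter> ?\<Gamma>. \<phi> x1 \<le> \<phi> y"
      by (intro continuous_attains_inf) auto
    then obtain x1 where x1: "x1 \<in> \<Omega>" "g x1 = 0" "\<phi> x1 \<le> \<phi> x2"
      and min: "\<And>y. y \<in> \<Omega> \<Longrightarrow> g y = 0 \<Longrightarrow> \<phi> y \<le> \<phi> x2 \<Longrightarrow> \<phi> x1 \<le> \<phi> y"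
      by auto
    have "\<phi> x1 \<le> \<phi> y" if "y \<in> \<Omega>" "g y = 0" for y
      using min[OF that] x1(3) by linarith
    with x1(1,2) show thesis by (rule that)
  qed
  define m where "m = \<phi> x1"
  obtain b where b: "\<And>x. x \<in> \<Omega> \<Longrightarrow> b \<le> \<phi> x"
    using f(1) by (auto simp: bounded_below_on_def f_\<phi>)
  have "\<exists>\<rho>>0. \<forall>x\<in>\<Omega>. m \<le> \<phi> x + \<rho> * g x"
  proof (rule local_penalties_imp_global_penalty[OF g compact_sub])
    fix x assume x: "x \<in> \<Omega>" "\<phi> x \<le> m"
    show "\<exists>\<rho>. \<forall>\<^sub>F y in nhds x. y \<in> \<Omega> \<longrightarrow> m \<le> \<phi> y + \<rho> * g y"
    proof (cases "g x = 0")
      case True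
      then have xm: "\<phi> x = m" using x x1 by (auto simp: m_def intro: antisym)
      have "x \<in> local_minimizers f ?\<Gamma>"
        using x True x1(3) xm f_\<phi>
        by (auto simp: local_minimizers_def is_arg_min_def m_def not_less intro!: exI[of _ 1])
      then obtain \<epsilon> \<rho> where "\<epsilon> > 0" "\<forall>y \<in> \<Omega> \<inter> cball x \<epsilon>. \<phi> x \<le> \<phi> y + \<rho> * g y"
        using pc by blast
      then show ?thesis
        unfolding eventually_nhds_metric xm
        by (intro exI[of _ \<rho>] exI[of _ \<epsilon>]) (auto simp: dist_commute)
    next
      case False
      then obtain c where c: "c > 0" "\<forall>\<^sub>F y in nhds x. c \<le> g y"
        using lower x(1) by blast
      define \<rho> where "\<rho> = \<bar>m - b\<bar> / c"
      have "m \<le> \<phi> y + \<rho> * g y" if "c \<le> g y" "y \<in> \<Omega>" for y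
      proof -
        have "m - b \<le> \<rho> * c" using c by (simp add: \<rho>_def)
        also have "\<dots> \<le> \<rho> * g y" using that c by (intro mult_left_mono) (auto simp: \<rho>_def)
        finally show ?thesis using b[OF that(2)] by linarith
      qed
      then show ?thesis
        using c(2) by (intro exI[of _ \<rho>]) (auto elim: eventually_mono)
    qed
  qed
  then obtain \<rho>1 where \<rho>1: "\<rho>1 > 0" "\<And>x. x \<in> \<Omega> \<Longrightarrow> m \<le> \<phi> x + \<rho>1 * g x"
    by blast
  have "global_minimizers (\<lambda>x. f x + ereal (\<rho> * g x)) \<Omega> = global_minimizers f ?\<Gamma>"
    if \<rho>: "\<rho> \<ge> \<rho>1 + 1" for \<rho>
  proof -
    \<comment> \<open>The extra unit in \<open>\<rho>\<close> turns \<open>m \<le> \<phi> + \<rho>1 * g\<close> into a bound that is strict off the zero set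
      of \<open>g\<close>.\<close>
    have low: "m + g x \<le> \<phi> x + \<rho> * g x" if "x \<in> \<Omega>" for x
      using \<rho>1(2)[OF that] mult_right_mono[OF \<rho> g[OF that]] by (simp add: algebra_simps)
    have char1: "x \<in> global_minimizers f ?\<Gamma> \<longleftrightarrow> x \<in> \<Omega> \<and> g x = 0 \<and> \<phi> x = m" for x
      using x1 unfolding global_minimizers_def is_arg_min_def m_def
      by (auto simp: f_\<phi> not_less intro: antisym)
    have "x \<in> global_minimizers (\<lambda>x. f x + ereal (\<rho> * g x)) \<Omega> \<longleftrightarrow>
        x \<in> \<Omega> \<and> (\<forall>y\<in>\<Omega>. \<phi> x + \<rho> * g x \<le> \<phi> y + \<rho> * g y)" for x
      unfolding global_minimizers_def is_arg_min_def by (auto simp: f_\<phi> not_less)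
    also have "\<dots> x \<longleftrightarrow> x \<in> \<Omega> \<and> g x = 0 \<and> \<phi> x = m" for x
    proof safe
      assume x: "x \<in> \<Omega>" "\<forall>y\<in>\<Omega>. \<phi> x + \<rho> * g x \<le> \<phi> y + \<rho> * g y"
      then have "\<phi> x + \<rho> * g x \<le> m"
        using x1 by (force simp: m_def)
      then have "g x \<le> 0" using low[OF x(1)] by linarith
      then show *: "g x = 0" using g[OF x(1)] by simp
      show "\<phi> x = m"
        using \<open>\<phi> x + \<rho> * g x \<le> m\<close> * low[OF x(1)] by simp
    next
      fix y assume "y \<in> \<Omega>" "g x = 0" "m = \<phi> x"
      then show "\<phi> x + \<rho> * g x \<le> \<phi> y + \<rho> * g y"
        using low[of y] g[of y] by simp
    qed
    finally show ?thesis using char1 by blast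
  qed
  then show "\<exists>\<rho>0>0. \<forall>\<rho>\<ge>\<rho>0. global_minimizers (\<lambda>x. f x + ereal (\<rho> * g x)) \<Omega> =
        global_minimizers f ?\<Gamma>"
    using \<rho>1(1) by (intro exI[of _ "\<rho>1 + 1"]) auto
qed

section \<open>Application to rank constraints\<close>

text \<open>
  The rank facts above verify the hypotheses of \<open>exact_penalty\<close> for
  \<open>g X = nuclear_norm X - ky_fan_norm r X\<close>. Rectangular and symmetric matrices are both covered:
  the latter merely restrict \<open>\<Omega>\<close>.
\<close>

lemma exact_penalty_rank:
  fixes \<Omega> :: "(real^'m^'n) set"
  assumes r: "r \<le> CARD('n)" and \<Omega>: "closed \<Omega>" "rank_feasible \<Omega> r \<noteq> {}"
    and f: "bounded_below_on \<Omega> f" "coercive_on \<Omega> f" "locally_lipschitz_on \<Omega> f"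
    and calm: "\<forall>X \<in> level_map \<Omega> r 0. calm_at (level_map \<Omega> r) 0 X"
  shows "(\<forall>X \<in> local_minimizers f (level_map \<Omega> r 0). partially_calm_at f \<Omega> r X) \<and>
    (\<exists>\<rho>0>0. \<forall>\<rho>\<ge>\<rho>0.
       global_minimizers (\<lambda>X. f X + ereal (\<rho> * (nuclear_norm X - ky_fan_norm r X))) \<Omega> =
       global_minimizers f (rank_feasible \<Omega> r))"
proof -
  let ?g = "\<lambda>X :: real^'m^'n. nuclear_norm X - ky_fan_norm r X"
  have level: "level_map \<Omega> r = (\<lambda>\<tau>. {X \<in> \<Omega>. ?g X = \<tau>})"
    by (rule ext) (simp only: level_map_def)
  have feasible: "rank_feasible \<Omega> r = {X \<in> \<Omega>. ?g X = 0}"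
    unfolding level_map_0_eq_rank_feasible[OF r, symmetric] level ..
  have lower: "\<exists>c>0. \<forall>\<^sub>F Y in nhds X. c \<le> ?g Y" if "X \<in> \<Omega>" "?g X \<noteq> 0" for X
    using nuclear_minus_ky_fan_pos_near_rank_gt[OF r, of X] nuclear_minus_ky_fan_eq_0_iff[OF r, of X] that
    by (simp only: not_le[symmetric]) blast
  have calm': "calm_at (\<lambda>\<tau>. {X \<in> \<Omega>. ?g X = \<tau>}) 0 X" if "X \<in> \<Omega>" "?g X = 0" for X
    using calm that unfolding level by blast
  have nonneg: "?g X \<ge> 0" if "X \<in> \<Omega>" for X
    by (rule nuclear_minus_ky_fan_nonneg[OF r])
  have local: "\<exists>\<epsilon>>0. \<exists>\<rho>>0. \<forall>Y \<in> \<Omega> \<inter> cball X \<epsilon>. f Y - f X + ereal (\<rho> * ?g Y) \<ge> 0"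
    if "X \<in> local_minimizers f {X \<in> \<Omega>. ?g X = 0}" for X
    by (rule partially_calm_at_local_minimizer[of \<Omega> f ?g, OF \<Omega>(1) f])
      (fact nonneg lower \<Omega>(2)[unfolded feasible] calm' that)+
  have global: "\<exists>\<rho>0>0. \<forall>\<rho>\<ge>\<rho>0. global_minimizers (\<lambda>X. f X + ereal (\<rho> * ?g X)) \<Omega> =
      global_minimizers f {X \<in> \<Omega>. ?g X = 0}"
    by (rule exact_penalty_threshold[of \<Omega> f ?g, OF \<Omega>(1) f])
      (fact nonneg lower \<Omega>(2)[unfolded feasible] calm')+
  have "partially_calm_at f \<Omega> r X" if X_min: "X \<in> local_minimizers f (level_map \<Omega> r 0)" for X
  proof -
    obtain \<epsilon> \<rho> where "\<epsilon> > 0" "\<rho> > 0" "\<forall>Y \<in> \<Omega> \<inter> cball X \<epsilon>. f Y - f X + ereal (\<rho> * ?g Y) \<ge> 0"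
      using local[of X] X_min unfolding level by blast
    then show ?thesis
      unfolding partially_calm_at_def level by blast
  qed
  then show ?thesis
    using global unfolding feasible by blast
qed

lemma bounded_below_on_subset: "bounded_below_on A f \<Longrightarrow> B \<subseteq> A \<Longrightarrow> bounded_below_on B f"
  unfolding bounded_below_on_def by blast

theorem theorem4p1:
  shows "(\<forall>(\<Omega> :: (real^'m^'n) set) (f :: real^'m^'n \<Rightarrow> ereal) (r :: nat).
       CARD('n) \<le> CARD('m) \<and> closed \<Omega> \<and> r \<in> {1..CARD('n)} \<and>
       rank_feasible \<Omega> r \<noteq> {} \<and>
       (\<forall>X\<in>UNIV. f X \<noteq> -\<infinity>) \<and> bounded_below_on UNIV f \<and>
       coercive_on \<Omega> f \<and> locally_lipschitz_on \<Omega> f \<and>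
       (\<forall>X \<in> level_map \<Omega> r 0. calm_at (level_map \<Omega> r) 0 X)
       \<longrightarrow>
       (\<forall>X \<in> local_minimizers f (level_map \<Omega> r 0). partially_calm_at f \<Omega> r X) \<and>
       (\<exists>\<rho>0>0. \<forall>\<rho>\<ge>\<rho>0.
          global_minimizers (\<lambda>X. f X + ereal (\<rho> * (nuclear_norm X - ky_fan_norm r X))) \<Omega> =
          global_minimizers f (rank_feasible \<Omega> r)))
   \<and>
   (\<forall>(\<Omega> :: (real^'n^'n) set) (f :: real^'n^'n \<Rightarrow> ereal) (r :: nat).
       \<Omega> \<subseteq> symmetric_matrices \<and> closed \<Omega> \<and> r \<in> {1..CARD('n)} \<and>
       rank_feasible \<Omega> r \<noteq> {} \<and>
       (\<forall>X\<in>symmetric_matrices. f X \<noteq> -\<infinity>) \<and> bounded_below_on symmetric_matrices f \<and>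
       coercive_on \<Omega> f \<and> locally_lipschitz_on \<Omega> f \<and>
       (\<forall>X \<in> level_map \<Omega> r 0. calm_at (level_map \<Omega> r) 0 X)
       \<longrightarrow>
       (\<forall>X \<in> local_minimizers f (level_map \<Omega> r 0). partially_calm_at f \<Omega> r X) \<and>
       (\<exists>\<rho>0>0. \<forall>\<rho>\<ge>\<rho>0.
          global_minimizers (\<lambda>X. f X + ereal (\<rho> * (nuclear_norm X - ky_fan_norm r X))) \<Omega> =
          global_minimizers f (rank_feasible \<Omega> r)))"
proof ((rule conjI; intro allI impI; elim conjE), goal_cases)
  case (1 \<Omega> f r)
  show ?case
    by (rule exact_penalty_rank) (use 1 bounded_below_on_subset[of UNIV f \<Omega>] in auto)
next
  case (2 \<Omega> f r)
  show ?case
    by (rule exact_penalty_rank) (use 2 bounded_below_on_subset[of symmetric_matrices f \<Omega>] in auto)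
qed

end
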